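(* Let $\{X_i: i\in \mathbb{N}\}$ be a collection of real Banach spaces, let $Y_i$ be a closed linear subspace of $X_i$ for every $i\in \mathbb{N}$, and let $1\leq p < \infty$. Let $X=(\oplus_pX_i)_{i \in \mathbb{N}}$ and $Y=(\oplus_pY_i)_{i \in \mathbb{N}}$. Then $(Y_i, CB(X_i))$ has property-$(lP_2)$ for every $i\in \mathbb{N}$ if and only if $(Y, \mathcal{P}(X))$ has property-$(lP_2)$.
   Context: For a real Banach space $X$, $CL(X)$ and $CB(X)$ denote the sets of non-empty closed, respectively non-empty closed bounded, subsets of $X$; $B_X$ is the closed unit ball. For $x\in X$ and $F\in CB(X)$, $r(x,F)=\sup\{\|x-a\|: a\in F\}$. For $V\in CL(X)$, $rad_V(F)=\inf\{r(v,F): v\in V\}$, $Z_V(F)=\{v\in V: r(v,F)=rad_V(F)\}$, and for $\delta\ge 0$, $Z_V(F,\delta)=\{v\in V: r(v,F)\le rad_V(F)+\delta\}$. $\mathcal{H}$ is the Hausdorff metric on $CB(X)$: $\mathcal{H}(A,B)=\inf\{r>0: A\subseteq B+rB_X,\ B\subseteq A+rB_X\}$. For $\mathcal{F}\subseteq CB(X)$, $(V,\mathcal{F})$ has property-$(lP_2)$ if $Z_V(G)\neq\emptyset$ for every $G\in\mathcal{F}$, and for every $\epsilon>0$ and $F\in\mathcal{F}$ there exists $\delta>0$ such that $Z_V(G,\delta)\subseteq Z_V(G)+\epsilon B_X$ whenever $G\in\mathcal{F}$ and $\mathcal{H}(F,G)<\delta$. $(\oplus_p X_i)_{i\in\mathbb{N}}$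 is the $\ell_p$-direct sum: all $x=(x_i)_{i\in\mathbb{N}}$ with $x_i\in X_i$ and $\|x\|=(\sum_{i}\|x_i\|^p)^{1/p}<\infty$; $Y=(\oplus_p Y_i)_{i\in\mathbb{N}}$ is regarded as a closed subspace of $X$. $\mathcal{P}(X)$ denotes the collection of all $F\in CB(X)$ of the form $F=\prod_{i\in\mathbb{N}}F_i$ (full Cartesian product, contained in $X$) with $F_i\in CB(X_i)$ for every $i$. *)

theory Defs
  imports "HOL-Analysis.Analysis" "HOL-Algebra.AbelCoset" "HOL-Algebra.Module"
begin

text \<open>
  The members of a family of Banach spaces must share one HOL type, and the norm of an
  l_p-sum depends on \<open>p\<close> and on the whole family, so Banach spaces are structures with an
  explicit carrier: real modules in the sense of HOL-Algebra together with a norm.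
  The fields \<open>mult\<close> and \<open>one\<close> that the module record inherits from rings carry no meaning.
\<close>

record 'a normed = "(real, 'a) module" +
  vnorm :: "'a \<Rightarrow> real"

definition real_ring :: "real ring" where
  "real_ring = \<lparr>carrier = UNIV, mult = (*), one = 1, zero = 0, add = (+)\<rparr>"

lemma cring_real_ring: "cring real_ring"
  unfolding real_ring_def
  by unfold_locales (auto simp: Units_def algebra_simps intro: exI[of _ "- _"])

text \<open>
  Outside the carrier the distance is set to 0, because the locale \<open>Metric_space\<close> asks for
  nonnegativity and symmetry on the whole type.
\<close>

definition vdist :: "('a, 'm) normed_scheme \<Rightarrow> 'a \<Rightarrow> 'a \<Rightarrow> real" where
  "vdist X x y =
    (if x \<in> carrier X \<and> y \<in> carrier X then vnorm X (x \<ominus>\<^bsub>X\<^esub> y) else 0)"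

definition vtopology :: "('a, 'm) normed_scheme \<Rightarrow> 'a topology" where
  "vtopology X = Metric_space.mtopology (carrier X) (vdist X)"

locale banach_space = module real_ring X for X :: "('a, 'm) normed_scheme" (structure) +
  assumes vnorm_eq_0: "x \<in> carrier X \<Longrightarrow> vnorm X x = 0 \<longleftrightarrow> x = \<zero>"
    and vnorm_triangle:
      "x \<in> carrier X \<Longrightarrow> y \<in> carrier X \<Longrightarrow> vnorm X (x \<oplus> y) \<le> vnorm X x + vnorm X y"
    and vnorm_smult: "x \<in> carrier X \<Longrightarrow> vnorm X (c \<odot> x) = \<bar>c\<bar> * vnorm X x"
    and complete: "Metric_space.mcomplete (carrier X) (vdist X)"

context banach_space
begin

lemma vnorm_minus: "x \<in> carrier X \<Longrightarrow> vnorm X (\<ominus> x) = vnorm X x"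
proof -
  assume x: "x \<in> carrier X"
  have c: "(1::real) \<in> carrier real_ring" by (simp add: real_ring_def)
  have m: "\<ominus>\<^bsub>real_ring\<^esub> 1 = -1"
    using R.add.inv_equality[of "-1" 1] by (simp add: a_inv_def real_ring_def)
  have "\<ominus> x = (-1) \<odot> x" using smult_l_minus[OF c x] smult_one[OF x] m
    by (simp add: real_ring_def)
  then show ?thesis using vnorm_smult[OF x, of "-1"] by simp
qed

lemma vnorm_nonneg: "x \<in> carrier X \<Longrightarrow> vnorm X x \<ge> 0"
  using vnorm_triangle[of x "\<ominus> x"] vnorm_minus[of x] vnorm_eq_0[of \<zero>] 
  by (simp add: M.r_neg)

lemma Metric_space_vdist: "Metric_space (carrier X) (vdist X)"
proof
  fix x y show "0 \<le> vdist X x y" by (auto simp: vdist_def vnorm_nonneg)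
next
  fix x y show "vdist X x y = vdist X y x"
    using vnorm_minus[of "x \<ominus> y"] by (auto simp: vdist_def M.minus_eq M.minus_add M.a_comm)
next
  fix x y assume "x \<in> carrier X" "y \<in> carrier X"
  then show "(vdist X x y = 0) = (x = y)"
    by (metis M.add.inv_closed M.minus_closed M.minus_equality M.minus_minus M.r_neg
        M.minus_eq vdist_def vnorm_eq_0)
next
  fix x y z assume a: "x \<in> carrier X" "y \<in> carrier X" "z \<in> carrier X"
  have "x \<ominus> z = (x \<ominus> y) \<oplus> (y \<ominus> z)" using a
    by (simp add: M.minus_eq M.a_assoc M.r_neg1)
  then show "vdist X x z \<le> vdist X x y + vdist X y z"
    using a vnorm_triangle[of "x \<ominus> y" "y \<ominus> z"] by (simp add: vdist_def)
qed

end

definition closed_subspace :: "('a, 'm) normed_scheme \<Rightarrow> 'a set \<Rightarrow> bool" where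
  "closed_subspace X V \<longleftrightarrow> submodule V real_ring X \<and> closedin (vtopology X) V"

definition CL :: "('a, 'm) normed_scheme \<Rightarrow> 'a set set" where
  "CL X = {A. A \<noteq> {} \<and> closedin (vtopology X) A}"

definition CB :: "('a, 'm) normed_scheme \<Rightarrow> 'a set set" where
  "CB X = {A \<in> CL X. Metric_space.mbounded (carrier X) (vdist X) A}"

definition unit_ball :: "('a, 'm) normed_scheme \<Rightarrow> 'a set" where
  "unit_ball X = {x \<in> carrier X. vnorm X x \<le> 1}"

text \<open>The set \<open>A + t B_X\<close>.\<close>

definition enlarge :: "('a, 'm) normed_scheme \<Rightarrow> 'a set \<Rightarrow> real \<Rightarrow> 'a set" where
  "enlarge X A t = A <+>\<^bsub>X\<^esub> ((\<lambda>b. t \<odot>\<^bsub>X\<^esub> b) ` unit_ball X)"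

definition hausdorff :: "('a, 'm) normed_scheme \<Rightarrow> 'a set \<Rightarrow> 'a set \<Rightarrow> real" where
  "hausdorff X A B = Inf {t. t > 0 \<and> A \<subseteq> enlarge X B t \<and> B \<subseteq> enlarge X A t}"

definition radius_at :: "('a, 'm) normed_scheme \<Rightarrow> 'a \<Rightarrow> 'a set \<Rightarrow> real" where
  "radius_at X x F = (SUP a\<in>F. vnorm X (x \<ominus>\<^bsub>X\<^esub> a))"

definition rad :: "('a, 'm) normed_scheme \<Rightarrow> 'a set \<Rightarrow> 'a set \<Rightarrow> real" where
  "rad X V F = (INF v\<in>V. radius_at X v F)"

definition centers :: "('a, 'm) normed_scheme \<Rightarrow> 'a set \<Rightarrow> 'a set \<Rightarrow> 'a set" where
  "centers X V F = {v \<in> V. radius_at X v F = rad X V F}"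

definition near_centers :: "('a, 'm) normed_scheme \<Rightarrow> 'a set \<Rightarrow> 'a set \<Rightarrow> real \<Rightarrow> 'a set" where
  "near_centers X V F \<delta> = {v \<in> V. radius_at X v F \<le> rad X V F + \<delta>}"

definition property_lP2 :: "('a, 'm) normed_scheme \<Rightarrow> 'a set \<Rightarrow> 'a set set \<Rightarrow> bool" where
  "property_lP2 X V \<F> \<longleftrightarrow>
    (\<forall>G\<in>\<F>. centers X V G \<noteq> {}) \<and>
    (\<forall>\<epsilon>>0. \<forall>F\<in>\<F>. \<exists>\<delta>>0. \<forall>G\<in>\<F>. hausdorff X F G < \<delta> \<longrightarrow>
        near_centers X V G \<delta> \<subseteq> enlarge X (centers X V G) \<epsilon>)"

definition lp_sum :: "real \<Rightarrow> (nat \<Rightarrow> 'a normed) \<Rightarrow> (nat \<Rightarrow> 'a) normed" where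
  "lp_sum p X =
    \<lparr> carrier = {x. (\<forall>i. x i \<in> carrier (X i)) \<and> summable (\<lambda>i. vnorm (X i) (x i) powr p)},
      mult = undefined, one = undefined,
      zero = (\<lambda>i. \<zero>\<^bsub>X i\<^esub>),
      add = (\<lambda>x y i. x i \<oplus>\<^bsub>X i\<^esub> y i),
      smult = (\<lambda>c x i. c \<odot>\<^bsub>X i\<^esub> x i),
      vnorm = (\<lambda>x. (\<Sum>i. vnorm (X i) (x i) powr p) powr (1 / p)) \<rparr>"

text \<open>
  The l_p-sum of subspaces \<open>Y i\<close>, each with the structure inherited from \<open>X i\<close>, as a
  subset of \<open>lp_sum p X\<close>.
\<close>

definition lp_subspace :: "real \<Rightarrow> (nat \<Rightarrow> 'a normed) \<Rightarrow> (nat \<Rightarrow> 'a set) \<Rightarrow> (nat \<Rightarrow> 'a) set" where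
  "lp_subspace p X Y = carrier (lp_sum p (\<lambda>i. (X i)\<lparr>carrier := Y i\<rparr>))"

definition closed_bounded_products ::
    "real \<Rightarrow> (nat \<Rightarrow> 'a normed) \<Rightarrow> (nat \<Rightarrow> 'a) set set" where
  "closed_bounded_products p X =
    {F \<in> CB (lp_sum p X). \<exists>F'. (\<forall>i. F' i \<in> CB (X i)) \<and> F = Pi UNIV F'}"

end

theory Submission
  imports Defs
begin

text \<open>
  For a product \<open>F = (\<Prod>i. F i)\<close> the suprema over the coordinates can be chosen independently, so
  \<open>r(x, F)\<^sup>p = (\<Sum>i. r(x i, F i)\<^sup>p)\<close>, and the centers of \<open>F\<close> are obtained coordinatewise.
  If every coordinate has the property and \<open>y\<close> is a near-center of \<open>G\<close>, then the excesses
  \<open>r(y i, G i)\<^sup>p - rad(G i)\<^sup>p\<close> are nonnegative with small sum. Hence finitely many \<open>y i\<close> are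
  near-centers of \<open>G i\<close> and can be moved to a center by assumption, while for the remaining \<open>i\<close> any
  center \<open>z i\<close> will do: \<open>\<parallel>y i - z i\<parallel> \<le> r(y i, G i) + rad(G i)\<close>, and
  \<open>rad(G i) \<le> r(0, G i)\<close> has a small \<open>p\<close>-tail because \<open>G\<close> is close to the fixed set \<open>F\<close>.
  Conversely, \<open>A \<mapsto> A \<times> \<Prod>\<^sub>j {0}\<close> embeds the \<open>i\<close>-th coordinate preserving radii and distances.
\<close>

subsection \<open>Real powers and series\<close>

text \<open>Because \<open>a + b \<le> 2 * max a b\<close>. The later estimates only need a constant
  that depends on \<open>p\<close> alone.\<close>

lemma powr_add_le:
  fixes a b p :: real
  assumes "0 \<le> a" "0 \<le> b" "0 \<le> p"
  shows "(a + b) powr p \<le> 2 powr p * (a powr p + b powr p)"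
proof -
  have "(a + b) powr p \<le> (2 * max a b) powr p"
    using assms by (intro powr_mono2) auto
  also have "\<dots> = 2 powr p * max a b powr p"
    using assms by (simp add: powr_mult)
  also have "\<dots> \<le> 2 powr p * (a powr p + b powr p)"
    by (intro mult_left_mono) (auto simp: max_def)
  finally show ?thesis .
qed

text \<open>Write \<open>x powr p = x * x powr (p - 1)\<close> and enlarge both inner bases to
  \<open>a + b\<close>. Later this turns a small excess of p-th powers into a small excess of
  radii.\<close>

lemma powr_add_ge:
  fixes a b p :: real
  assumes "0 \<le> a" "0 \<le> b" "1 \<le> p"
  shows "a powr p + b powr p \<le> (a + b) powr p"
proof -
  have *: "x powr p = x * x powr (p - 1)" if "0 \<le> x" for x
    using that powr_mult_base[of x "p - 1"] by simp
  have "a * a powr (p - 1) + b * b powr (p - 1) \<le> a * (a + b) powr (p - 1) + b * (a + b) powr (p - 1)"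
    using assms by (intro add_mono mult_left_mono powr_mono2) auto
  then show ?thesis
    using assms by (simp add: * ring_distribs)
qed

lemma powr_convex_le:
  fixes x y u v p :: real
  assumes "0 \<le> x" "0 \<le> y" "0 \<le> u" "0 \<le> v" "u + v = 1" "1 \<le> p"
  shows "(u * x + v * y) powr p \<le> u * x powr p + v * y powr p"
proof -
  \<comment> \<open>For a vanishing argument only one scaled term is left, and
    \<open>t powr p \<le> t\<close> settles it; positive arguments fall under convexity.\<close>
  have *: "(t * z) powr p \<le> t * z powr p" if "0 \<le> t" "t \<le> 1" "0 \<le> z" for t z :: real
  proof -
    have "t powr p \<le> t"
      using that powr_mono'[of 1 p t] assms by (cases "t = 0") auto
    then show ?thesis
      using that by (simp add: powr_mult mult_right_mono)
  qed
  show ?thesis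
  proof (cases "x = 0 \<or> y = 0")
    case True
    then show ?thesis
      using assms *[of u x] *[of v y] by auto
  next
    case False
    then show ?thesis
      using assms convex_onD[OF powr_convex[of p], of v x y]
      by (simp add: algebra_simps flip: eq_diff_eq)
  qed
qed

text \<open>By convexity: with \<open>a\<close>, \<open>b\<close> just above the two norms,
  \<open>f + g\<close> is \<open>a + b\<close> times a convex combination of the normalised
  sequences \<open>f / a\<close> and \<open>g / b\<close>, whose p-sums are at most 1.\<close>

lemma Minkowski_suminf:
  fixes f g :: "nat \<Rightarrow> real"
  assumes p: "1 \<le> p" and pos: "\<And>i. 0 \<le> f i" "\<And>i. 0 \<le> g i"
    and f: "summable (\<lambda>i. f i powr p)" and g: "summable (\<lambda>i. g i powr p)"
  shows "summable (\<lambda>i. (f i + g i) powr p)"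
    and "(\<Sum>i. (f i + g i) powr p) powr (1 / p)
      \<le> (\<Sum>i. f i powr p) powr (1 / p) + (\<Sum>i. g i powr p) powr (1 / p)"
proof -
  show s: "summable (\<lambda>i. (f i + g i) powr p)"
    using p pos
    by (intro summable_comparison_test'[OF summable_mult[OF summable_add[OF f g], of "2 powr p"]])
       (auto intro!: powr_add_le)
  define A where "A = (\<Sum>i. f i powr p) powr (1 / p)"
  define B where "B = (\<Sum>i. g i powr p) powr (1 / p)"
  have fA: "(\<Sum>i. f i powr p) = A powr p" and gB: "(\<Sum>i. g i powr p) = B powr p"
    using p f g by (auto simp: A_def B_def powr_powr suminf_nonneg)
  have AB: "0 \<le> A" "0 \<le> B" by (auto simp: A_def B_def)
  show "(\<Sum>i. (f i + g i) powr p) powr (1 / p) \<le> (\<Sum>i. f i powr p) powr (1 / p) + (\<Sum>i. g i powr p) powr (1 / p)"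
    unfolding A_def[symmetric] B_def[symmetric]
  proof (rule field_le_epsilon)
    \<comment> \<open>The slack \<open>e\<close> makes both normalising constants positive even if a
      norm vanishes.\<close>
    fix e :: real assume e: "0 < e"
    define a b where "a = A + e / 2" and "b = B + e / 2"
    have ab: "0 < a" "0 < b" "A \<le> a" "B \<le> b" using e AB by (auto simp: a_def b_def)
    define u v where "u = a / (a + b)" and "v = b / (a + b)"
    have uv: "0 \<le> u" "0 \<le> v" "u + v = 1"
      using ab by (auto simp: u_def v_def simp flip: add_divide_distrib)
    have le: "(f i + g i) powr p \<le> (a + b) powr p * (u * (f i powr p / a powr p) + v * (g i powr p / b powr p))"
      for i
    proof -
      have "(a + b) * (u * (f i / a)) = f i" "(a + b) * (v * (g i / b)) = g i"
        using ab by (auto simp: u_def v_def)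
      then have "f i + g i = (a + b) * (u * (f i / a) + v * (g i / b))"
        by (simp only: distrib_left)
      then have "(f i + g i) powr p = (a + b) powr p * (u * (f i / a) + v * (g i / b)) powr p"
        using ab uv pos[of i] by (simp add: powr_mult)
      also have "\<dots> \<le> (a + b) powr p * (u * (f i / a) powr p + v * (g i / b) powr p)"
        using ab uv pos[of i] p by (intro mult_left_mono powr_convex_le) auto
      finally show ?thesis
        using ab pos[of i] by (simp add: powr_divide)
    qed
    have sums: "(\<lambda>i. (a + b) powr p * (u * (f i powr p / a powr p) + v * (g i powr p / b powr p))) sums
      ((a + b) powr p * (u * (A powr p / a powr p) + v * (B powr p / b powr p)))"
      by (intro sums_mult sums_add sums_divide) (use f g fA gB summable_sums in \<open>metis+\<close>)
    have "A powr p / a powr p \<le> 1" "B powr p / b powr p \<le> 1"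
      using ab AB p by (auto intro!: powr_mono2 simp: divide_le_eq)
    then have "u * (A powr p / a powr p) + v * (B powr p / b powr p) \<le> u * 1 + v * 1"
      using uv by (intro add_mono mult_left_mono) auto
    then have "(\<Sum>i. (f i + g i) powr p) \<le> (a + b) powr p"
      using suminf_le[OF le s sums_summable[OF sums]] sums_unique[OF sums] uv
        mult_left_le[of "u * (A powr p / a powr p) + v * (B powr p / b powr p)" "(a + b) powr p"]
      by simp
    then have "(\<Sum>i. (f i + g i) powr p) powr (1 / p) \<le> ((a + b) powr p) powr (1 / p)"
      using p s by (intro powr_mono2 suminf_nonneg) auto
    also have "\<dots> = A + B + e"
      using p ab by (simp add: powr_powr a_def b_def)
    finally show "(\<Sum>i. (f i + g i) powr p) powr (1 / p) \<le> A + B + e" .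
  qed
qed

lemma powr_le_imp_le:
  fixes a b p :: real
  assumes "a powr p \<le> b powr p" "0 \<le> b" "0 < p"
  shows "a \<le> b"
  using assms powr_less_mono2[of p b a] by force

text \<open>Uniform continuity on a compact interval. It makes the passage from radii to their p-th
  powers uniform over all sets with radius at most \<open>M\<close>.\<close>

lemma powr_increment_uniform:
  fixes p M e :: real
  assumes "0 < p" "0 < e"
  shows "\<exists>d>0. \<forall>x t. 0 \<le> x \<and> x \<le> M \<and> 0 \<le> t \<and> t \<le> d \<longrightarrow> (x + t) powr p \<le> x powr p + e"
proof -
  have "continuous_on {0..M + 1} (\<lambda>x. x powr p)"
    using assms by (intro continuous_on_powr') (auto intro!: continuous_intros)
  then have "uniformly_continuous_on {0..M + 1} (\<lambda>x. x powr p)"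
    by (intro compact_uniformly_continuous) auto
  then obtain d where d: "d > 0"
    "\<And>x x'. x \<in> {0..M + 1} \<Longrightarrow> x' \<in> {0..M + 1} \<Longrightarrow> dist x' x < d \<Longrightarrow> dist (x' powr p) (x powr p) < e"
    using assms unfolding uniformly_continuous_on_def by metis
  show ?thesis
  \<comment> \<open>Increments of at most 1 keep \<open>x + t\<close> inside
    \<open>{0..M + 1}\<close>; halving \<open>d\<close> gives the strict inequality.\<close>
  proof (intro exI[of _ "min 1 (d / 2)"] conjI allI impI)
    fix x t assume x: "0 \<le> x \<and> x \<le> M \<and> 0 \<le> t \<and> t \<le> min 1 (d / 2)"
    then have "dist ((x + t) powr p) (x powr p) < e"
      using d(1) by (intro d(2)) (auto simp: dist_real_def)
    then show "(x + t) powr p \<le> x powr p + e"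
      by (auto simp: dist_real_def)
  qed (use d in auto)
qed

lemma suminf_tail_le:
  fixes f :: "nat \<Rightarrow> real"
  assumes "summable f" "\<And>i. 0 \<le> f i"
  shows "(\<Sum>i. f (i + n)) \<le> suminf f"
  using suminf_split_initial_segment[OF assms(1), of n] sum_nonneg[of "{..<n}" f] assms(2) by simp

subsection \<open>Normed modules\<close>

text \<open>
  The locale \<open>banach_space\<close> without completeness, so that the \<open>l\<^sub>p\<close>-sum is a model of it by
  Minkowski's inequality alone.
\<close>

locale normed_module = module real_ring X for X :: "('a, 'm) normed_scheme" (structure) +
  assumes vnorm_eq_0: "x \<in> carrier X \<Longrightarrow> vnorm X x = 0 \<longleftrightarrow> x = \<zero>"
    and vnorm_triangle:
      "x \<in> carrier X \<Longrightarrow> y \<in> carrier X \<Longrightarrow> vnorm X (x \<oplus> y) \<le> vnorm X x + vnorm X y"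
    and vnorm_smult: "x \<in> carrier X \<Longrightarrow> vnorm X (c \<odot> x) = \<bar>c\<bar> * vnorm X x"

lemma (in banach_space) normed_module: "normed_module X"
  by unfold_locales (auto simp: vnorm_eq_0 vnorm_triangle vnorm_smult)

context normed_module
begin

lemma scalar_in_carrier [simp]: "c \<in> carrier real_ring"
  by (simp add: real_ring_def)

lemma vnorm_zero [simp]: "vnorm X \<zero> = 0"
  by (simp add: vnorm_eq_0)

lemma vnorm_minus: "x \<in> carrier X \<Longrightarrow> vnorm X (\<ominus> x) = vnorm X x"
proof -
  assume x: "x \<in> carrier X"
  have "\<ominus>\<^bsub>real_ring\<^esub> 1 = -1"
    using R.add.inv_equality[of "-1" 1] by (simp add: a_inv_def real_ring_def)
  then have "\<ominus> x = (-1) \<odot> x"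
    using smult_l_minus[OF _ x, of 1] smult_one[OF x] by (simp add: real_ring_def)
  then show ?thesis using vnorm_smult[OF x, of "-1"] by simp
qed

lemma vnorm_nonneg: "x \<in> carrier X \<Longrightarrow> 0 \<le> vnorm X x"
  using vnorm_triangle[of x "\<ominus> x"] vnorm_minus[of x] by (simp add: M.r_neg)

lemma vnorm_diff_nonneg: "x \<in> carrier X \<Longrightarrow> y \<in> carrier X \<Longrightarrow> 0 \<le> vnorm X (x \<ominus> y)"
  by (simp add: vnorm_nonneg)

lemma vnorm_diff_commute:
  "x \<in> carrier X \<Longrightarrow> y \<in> carrier X \<Longrightarrow> vnorm X (x \<ominus> y) = vnorm X (y \<ominus> x)"
  using vnorm_minus[of "x \<ominus> y"] by (simp add: M.minus_eq M.minus_add M.a_comm)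

lemma minus_zero [simp]: "x \<in> carrier X \<Longrightarrow> x \<ominus> \<zero> = x"
  by (simp add: M.minus_eq)

lemma zero_minus [simp]: "x \<in> carrier X \<Longrightarrow> \<zero> \<ominus> x = \<ominus> x"
  by (simp add: M.minus_eq)

lemma vnorm_diff_eq_0:
  "x \<in> carrier X \<Longrightarrow> y \<in> carrier X \<Longrightarrow> vnorm X (x \<ominus> y) = 0 \<longleftrightarrow> x = y"
  by (metis M.add.inv_closed M.minus_closed M.minus_equality M.minus_minus M.r_neg
        M.minus_eq vnorm_eq_0)

lemma vnorm_diff_triangle:
  assumes "x \<in> carrier X" "y \<in> carrier X" "z \<in> carrier X"
  shows "vnorm X (x \<ominus> z) \<le> vnorm X (x \<ominus> y) + vnorm X (y \<ominus> z)"
proof -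
  have "x \<ominus> z = (x \<ominus> y) \<oplus> (y \<ominus> z)"
    using assms by (simp add: M.minus_eq M.a_assoc M.r_neg1)
  then show ?thesis
    using assms vnorm_triangle[of "x \<ominus> y" "y \<ominus> z"] by simp
qed

sublocale Metric_space "carrier X" "vdist X"
  by unfold_locales
    (auto simp: vdist_def vnorm_diff_nonneg vnorm_diff_eq_0 intro: vnorm_diff_commute vnorm_diff_triangle)

section \<open>Closed bounded sets, their radii and restricted radii\<close>

lemma mem_CB_iff:
  "A \<in> CB X \<longleftrightarrow> A \<noteq> {} \<and> closedin mtopology A \<and> (\<exists>B. \<forall>a\<in>A. vnorm X a \<le> B)"
proof -
  have "mbounded A \<longleftrightarrow> (\<exists>B. \<forall>a\<in>A. vnorm X a \<le> B)" if A: "A \<noteq> {}" "A \<subseteq> carrier X"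
  proof
    assume "mbounded A"
    then obtain y B where y: "y \<in> carrier X" "\<And>x. x \<in> A \<Longrightarrow> vdist X y x \<le> B"
      using A \<open>mbounded A\<close> unfolding mbounded by blast
    have "vnorm X a \<le> vnorm X y + B" if "a \<in> A" for a
    proof -
      have "a \<in> carrier X" using that A by auto
      then show ?thesis
        using y(1) y(2)[OF that] vnorm_diff_triangle[of \<zero> y a]
        by (simp add: vdist_def vnorm_minus)
    qed
    then show "\<exists>B. \<forall>a\<in>A. vnorm X a \<le> B" by blast
  next
    assume "\<exists>B. \<forall>a\<in>A. vnorm X a \<le> B"
    then show "mbounded A"
      using A unfolding mbounded
      by (intro disjI2 conjI exI[of _ \<zero>]) (auto simp: vdist_def vnorm_minus subset_iff)
  qed
  then show ?thesis
    unfolding CB_def CL_def vtopology_def using closedin_subset[of mtopology A] by auto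
qed

lemma CB_carrier: "A \<in> CB X \<Longrightarrow> a \<in> A \<Longrightarrow> a \<in> carrier X"
  using closedin_subset by (fastforce simp: mem_CB_iff)

lemma CB_nonempty: "A \<in> CB X \<Longrightarrow> A \<noteq> {}"
  by (simp add: mem_CB_iff)

lemma zero_singleton_in_CB: "{\<zero>} \<in> CB X"
  by (auto simp: mem_CB_iff closedin_Hausdorff_singleton Hausdorff_space_mtopology)

lemma bdd_above_radius:
  assumes "A \<in> CB X" "x \<in> carrier X"
  shows "bdd_above ((\<lambda>a. vnorm X (x \<ominus> a)) ` A)"
proof -
  obtain B where B: "\<And>a. a \<in> A \<Longrightarrow> vnorm X a \<le> B"
    using assms by (auto simp: mem_CB_iff)
  have "vnorm X (x \<ominus> a) \<le> vnorm X x + B" if "a \<in> A" for a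
    using vnorm_diff_triangle[of x \<zero> a] B[OF that] CB_carrier[OF assms(1) that] assms(2)
    by (simp add: vnorm_minus)
  then show ?thesis
    by (auto simp: bdd_above_def)
qed

lemma radius_at_upper:
  "A \<in> CB X \<Longrightarrow> x \<in> carrier X \<Longrightarrow> a \<in> A \<Longrightarrow> vnorm X (x \<ominus> a) \<le> radius_at X x A"
  unfolding radius_at_def by (intro cSUP_upper bdd_above_radius)

lemma radius_at_least:
  "A \<in> CB X \<Longrightarrow> (\<And>a. a \<in> A \<Longrightarrow> vnorm X (x \<ominus> a) \<le> r) \<Longrightarrow> radius_at X x A \<le> r"
  unfolding radius_at_def by (intro cSUP_least) (auto simp: mem_CB_iff)

lemma radius_at_nonneg: "A \<in> CB X \<Longrightarrow> x \<in> carrier X \<Longrightarrow> 0 \<le> radius_at X x A"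
  using radius_at_upper[of A x] vnorm_diff_nonneg[of x] CB_carrier[of A] CB_nonempty[of A]
  by (meson all_not_in_conv order_trans)

lemma radius_at_zero_upper: "A \<in> CB X \<Longrightarrow> a \<in> A \<Longrightarrow> vnorm X a \<le> radius_at X \<zero> A"
  using radius_at_upper[of A \<zero> a] CB_carrier[of A a] by (simp add: vnorm_minus)

text \<open>The supremum need not be attained. An error in the form of a factor, unlike an additive
  one, can be pulled out of an infinite p-sum.\<close>

lemma ex_scaled_radius_at_le:
  assumes "A \<in> CB X" "x \<in> carrier X" "0 \<le> c" "c < 1"
  shows "\<exists>a\<in>A. c * radius_at X x A \<le> vnorm X (x \<ominus> a)"
proof (cases "radius_at X x A = 0")
  case True
  then show ?thesis
    using assms CB_nonempty[of A] CB_carrier[of A] vnorm_diff_nonneg[of x] by fastforce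
next
  case False
  then have "c * radius_at X x A < radius_at X x A"
    using assms radius_at_nonneg[of A x] by (auto simp: mult_less_cancel_right1)
  then show ?thesis
    using less_cSUP_iff[OF CB_nonempty[OF assms(1)] bdd_above_radius[OF assms(1,2)]]
    unfolding radius_at_def[of X x A] by (auto intro: less_imp_le)
qed

lemma rad_lower:
  "A \<in> CB X \<Longrightarrow> V \<subseteq> carrier X \<Longrightarrow> v \<in> V \<Longrightarrow> rad X V A \<le> radius_at X v A"
  unfolding rad_def by (intro cINF_lower bdd_belowI2[of _ 0] radius_at_nonneg) auto

lemma rad_greatest:
  "V \<noteq> {} \<Longrightarrow> (\<And>v. v \<in> V \<Longrightarrow> r \<le> radius_at X v A) \<Longrightarrow> r \<le> rad X V A"
  unfolding rad_def by (intro cINF_greatest)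

lemma rad_nonneg: "A \<in> CB X \<Longrightarrow> V \<subseteq> carrier X \<Longrightarrow> V \<noteq> {} \<Longrightarrow> 0 \<le> rad X V A"
  by (intro rad_greatest radius_at_nonneg) auto

section \<open>Enlargements and the Hausdorff distance as distance conditions\<close>

lemma mem_enlarge_iff:
  assumes "A \<subseteq> carrier X" "0 < t"
  shows "x \<in> enlarge X A t \<longleftrightarrow> x \<in> carrier X \<and> (\<exists>a\<in>A. vnorm X (x \<ominus> a) \<le> t)"
proof
  assume "x \<in> enlarge X A t"
  then obtain a b where ab: "a \<in> A" "b \<in> carrier X" "vnorm X b \<le> 1" "x = a \<oplus> t \<odot> b"
    by (auto simp: enlarge_def set_add_def' unit_ball_def)
  have a: "a \<in> carrier X" using ab assms by auto
  then have "x \<ominus> a = t \<odot> b"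
    using ab by (simp add: M.minus_eq M.a_ac M.r_neg1 M.r_neg2 M.r_neg)
  then show "x \<in> carrier X \<and> (\<exists>a\<in>A. vnorm X (x \<ominus> a) \<le> t)"
    using ab a assms(2) by (auto intro!: bexI[of _ a] simp: vnorm_smult mult_left_le)
next
  assume "x \<in> carrier X \<and> (\<exists>a\<in>A. vnorm X (x \<ominus> a) \<le> t)"
  then obtain a where a: "x \<in> carrier X" "a \<in> A" "a \<in> carrier X" "vnorm X (x \<ominus> a) \<le> t"
    using assms by auto
  \<comment> \<open>The element of the unit ball is the difference rescaled by
    \<open>1 / t\<close>.\<close>
  define b where "b = (1 / t) \<odot> (x \<ominus> a)"
  have b: "b \<in> unit_ball X"
    using a assms(2) by (auto simp: b_def unit_ball_def vnorm_smult field_simps)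
  have "t \<odot> b = (x \<ominus> a)"
    using a assms(2) smult_assoc1[of t "1 / t" "x \<ominus> a"] smult_one[of "x \<ominus> a"]
    by (simp add: b_def real_ring_def)
  moreover have "a \<oplus> (x \<oplus> \<ominus> a) = x \<oplus> (a \<oplus> \<ominus> a)"
    using a by (intro M.a_lcomm) auto
  ultimately have "x = a \<oplus> t \<odot> b"
    using a by (simp add: M.minus_eq M.r_neg)
  then show "x \<in> enlarge X A t"
    unfolding enlarge_def set_add_def' using a b by auto
qed

lemma hausdorff_lessD:
  assumes "A \<in> CB X" "B \<in> CB X" "hausdorff X A B < d"
  shows "\<exists>t. 0 < t \<and> t < d \<and> (\<forall>a\<in>A. \<exists>b\<in>B. vnorm X (a \<ominus> b) \<le> t) \<and> (\<forall>b\<in>B. \<exists>a\<in>A. vnorm X (b \<ominus> a) \<le> t)"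
proof -
  let ?S = "{t. t > 0 \<and> A \<subseteq> enlarge X B t \<and> B \<subseteq> enlarge X A t}"
  have sub: "A \<subseteq> carrier X" "B \<subseteq> carrier X"
    using assms CB_carrier by auto
  obtain a b where ab: "a \<in> A" "b \<in> B"
    using assms CB_nonempty by blast
  \<comment> \<open>An admissible radius, so that the infimum is over a nonempty set:
    \<open>b\<close> is within \<open>t\<close> of all of \<open>A\<close> and \<open>a\<close> of
    all of \<open>B\<close>, and the summand 1 keeps \<open>t\<close> positive.\<close>
  define t where "t = 1 + radius_at X a B + radius_at X b A"
  have ge: "0 \<le> radius_at X a B" "0 \<le> radius_at X b A"
    using ab sub assms by (auto intro!: radius_at_nonneg)
  have "vnorm X (x \<ominus> b) \<le> t" if "x \<in> A" for x
    using radius_at_upper[of A b x] vnorm_diff_commute[of x b] ab sub assms that ge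
    by (auto simp: t_def subset_iff)
  moreover have "vnorm X (x \<ominus> a) \<le> t" if "x \<in> B" for x
    using radius_at_upper[of B a x] vnorm_diff_commute[of x a] ab sub assms that ge
    by (auto simp: t_def subset_iff)
  ultimately have "t \<in> ?S"
    using ge ab sub by (auto simp: mem_enlarge_iff t_def subset_iff)
  then obtain s where "s \<in> ?S" "s < d"
    using cInf_lessD[of ?S d] assms(3) unfolding hausdorff_def by blast
  then show ?thesis
    using sub by (auto simp: mem_enlarge_iff subset_iff)
qed

lemma hausdorff_le:
  assumes "A \<subseteq> carrier X" "B \<subseteq> carrier X" "0 < t"
    "\<And>a. a \<in> A \<Longrightarrow> \<exists>b\<in>B. vnorm X (a \<ominus> b) \<le> t"
    "\<And>b. b \<in> B \<Longrightarrow> \<exists>a\<in>A. vnorm X (b \<ominus> a) \<le> t"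
  shows "hausdorff X A B \<le> t"
  unfolding hausdorff_def
proof (rule cInf_lower)
  show "t \<in> {t. t > 0 \<and> A \<subseteq> enlarge X B t \<and> B \<subseteq> enlarge X A t}"
    using assms by (auto simp: mem_enlarge_iff)
  show "bdd_below {t. t > 0 \<and> A \<subseteq> enlarge X B t \<and> B \<subseteq> enlarge X A t}"
    by (rule bdd_belowI[of _ 0]) simp
qed

end

subsection \<open>The p-sum of normed modules\<close>

locale lp_family =
  fixes X :: "nat \<Rightarrow> 'a normed" and p :: real
  assumes normed_module: "\<And>i. normed_module (X i)" and p: "1 \<le> p"
begin

sublocale N: normed_module "X i" for i
  by (rule normed_module)

abbreviation L :: "(nat \<Rightarrow> 'a) normed" where "L \<equiv> lp_sum p X"

section \<open>Linear structure and norm of the p-sum\<close>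

lemma lp_carrier_iff:
  "x \<in> carrier L \<longleftrightarrow> (\<forall>i. x i \<in> carrier (X i)) \<and> summable (\<lambda>i. vnorm (X i) (x i) powr p)"
  by (simp add: lp_sum_def)

lemma lp_zero [simp]: "\<zero>\<^bsub>L\<^esub> = (\<lambda>i. \<zero>\<^bsub>X i\<^esub>)"
  and lp_add [simp]: "x \<oplus>\<^bsub>L\<^esub> y = (\<lambda>i. x i \<oplus>\<^bsub>X i\<^esub> y i)"
  and lp_smult [simp]: "c \<odot>\<^bsub>L\<^esub> x = (\<lambda>i. c \<odot>\<^bsub>X i\<^esub> x i)"
  and lp_vnorm: "vnorm L x = (\<Sum>i. vnorm (X i) (x i) powr p) powr (1 / p)"
  by (simp_all add: lp_sum_def)

lemma lp_coord: "x \<in> carrier L \<Longrightarrow> x i \<in> carrier (X i)"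
  by (simp add: lp_carrier_iff)

lemma lp_carrierI:
  assumes "\<And>i. x i \<in> carrier (X i)" "summable g" "\<And>i. vnorm (X i) (x i) powr p \<le> g i"
  shows "x \<in> carrier L"
  unfolding lp_carrier_iff using assms
  by (auto intro: summable_comparison_test'[OF assms(2)])

lemma lp_zero_closed: "(\<lambda>i. \<zero>\<^bsub>X i\<^esub>) \<in> carrier L"
  by (simp add: lp_carrier_iff)

lemma lp_add_closed:
  assumes "x \<in> carrier L" "y \<in> carrier L"
  shows "(\<lambda>i. x i \<oplus>\<^bsub>X i\<^esub> y i) \<in> carrier L"
proof (rule lp_carrierI)
  show "summable (\<lambda>i. (vnorm (X i) (x i) + vnorm (X i) (y i)) powr p)"
    using assms by (intro Minkowski_suminf p) (auto simp: lp_carrier_iff N.vnorm_nonneg)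
  show "vnorm (X i) (x i \<oplus>\<^bsub>X i\<^esub> y i) powr p \<le> (vnorm (X i) (x i) + vnorm (X i) (y i)) powr p" for i
    using assms p by (intro powr_mono2 N.vnorm_triangle N.vnorm_nonneg N.M.a_closed lp_coord) auto
qed (use assms in \<open>auto simp: lp_coord\<close>)

lemma lp_minus_closed:
  assumes "x \<in> carrier L"
  shows "(\<lambda>i. \<ominus>\<^bsub>X i\<^esub> x i) \<in> carrier L"
  using assms by (simp add: lp_carrier_iff N.vnorm_minus)

lemma lp_smult_closed:
  assumes "x \<in> carrier L"
  shows "(\<lambda>i. c \<odot>\<^bsub>X i\<^esub> x i) \<in> carrier L"
  using assms by (simp add: lp_carrier_iff N.vnorm_smult powr_mult summable_mult)

lemma lp_abelian_group: "abelian_group L"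
proof (rule abelian_groupI, goal_cases)
  \<comment> \<open>The existence of an additive inverse, taken coordinatewise.\<close>
  case (6 x)
  then show ?case
    using lp_minus_closed[of x]
    by (intro bexI[of _ "\<lambda>i. \<ominus>\<^bsub>X i\<^esub> x i"]) (auto simp: lp_coord N.M.l_neg)
qed (auto simp: lp_zero_closed lp_add_closed lp_coord N.M.a_ac)

text \<open>The triangle inequality is the coordinatewise one followed by Minkowski's inequality;
  definiteness holds because a nonnegative series with sum zero has only zero terms.\<close>

lemma lp_normed_module: "normed_module L"
proof (intro normed_module.intro normed_module_axioms.intro module.intro module_axioms.intro)
  fix x y and c :: real assume x: "x \<in> carrier L" and y: "y \<in> carrier L"
  have sx: "summable (\<lambda>i. vnorm (X i) (x i) powr p)" and cx: "\<And>i. x i \<in> carrier (X i)"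
   and sy: "summable (\<lambda>i. vnorm (X i) (y i) powr p)" and cy: "\<And>i. y i \<in> carrier (X i)"
    using x y by (auto simp: lp_carrier_iff)
  have "vnorm L (x \<oplus>\<^bsub>L\<^esub> y) \<le> (\<Sum>i. (vnorm (X i) (x i) + vnorm (X i) (y i)) powr p) powr (1 / p)"
    unfolding lp_vnorm lp_add using p lp_add_closed[OF x y]
    by (intro powr_mono2 suminf_le suminf_nonneg Minkowski_suminf(1) sx sy)
       (auto simp: lp_carrier_iff cx cy intro!: N.vnorm_triangle N.vnorm_nonneg powr_mono2)
  also have "\<dots> \<le> vnorm L x + vnorm L y"
    unfolding lp_vnorm by (intro Minkowski_suminf p sx sy) (auto simp: cx cy N.vnorm_nonneg)
  finally show "vnorm L (x \<oplus>\<^bsub>L\<^esub> y) \<le> vnorm L x + vnorm L y" .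
next
  fix x and c :: real assume x: "x \<in> carrier L"
  then have sx: "summable (\<lambda>i. vnorm (X i) (x i) powr p)" and cx: "\<And>i. x i \<in> carrier (X i)"
    by (auto simp: lp_carrier_iff)
  show "vnorm L (c \<odot>\<^bsub>L\<^esub> x) = \<bar>c\<bar> * vnorm L x"
    using p by (simp add: lp_vnorm N.vnorm_smult cx powr_mult suminf_mult sx suminf_nonneg powr_powr)
  have "vnorm L x = 0 \<longleftrightarrow> (\<forall>i. vnorm (X i) (x i) powr p = 0)"
    unfolding lp_vnorm using suminf_eq_zero_iff[OF sx] by simp
  also have "\<dots> \<longleftrightarrow> x = \<zero>\<^bsub>L\<^esub>"
    by (auto simp: N.vnorm_eq_0 cx)
  finally show "vnorm L x = 0 \<longleftrightarrow> x = \<zero>\<^bsub>L\<^esub>" .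
next
  show "cring real_ring" by (rule cring_real_ring)
  show "abelian_group L" by (rule lp_abelian_group)
qed (use N.smult_l_distr N.smult_r_distr N.smult_assoc1 in \<open>auto simp: lp_smult_closed lp_coord\<close>)

sublocale L: normed_module L
  by (rule lp_normed_module)

text \<open>Subtraction in \<open>L\<close> goes through the abstract additive inverse, so it is
  coordinatewise only by uniqueness of inverses in the carrier.\<close>

lemma lp_minus:
  assumes "x \<in> carrier L" "y \<in> carrier L"
  shows "(x \<ominus>\<^bsub>L\<^esub> y) i = x i \<ominus>\<^bsub>X i\<^esub> y i"
proof -
  have "\<ominus>\<^bsub>L\<^esub> y = (\<lambda>i. \<ominus>\<^bsub>X i\<^esub> y i)"
    using assms lp_minus_closed[of y]
    by (intro L.M.minus_equality) (auto simp: lp_coord N.M.l_neg)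
  then show ?thesis by (simp add: a_minus_def)
qed

lemma vnorm_powr_sums:
  assumes "x \<in> carrier L"
  shows "(\<lambda>i. vnorm (X i) (x i) powr p) sums (vnorm L x powr p)"
  using assms p by (simp add: lp_carrier_iff lp_vnorm powr_powr suminf_nonneg summable_sums)

lemma vnorm_minus_powr_sums:
  assumes "x \<in> carrier L" "y \<in> carrier L"
  shows "(\<lambda>i. vnorm (X i) (x i \<ominus>\<^bsub>X i\<^esub> y i) powr p) sums (vnorm L (x \<ominus>\<^bsub>L\<^esub> y) powr p)"
  using vnorm_powr_sums[of "x \<ominus>\<^bsub>L\<^esub> y"] assms by (simp add: lp_minus)

lemma vnorm_coord_le:
  assumes "x \<in> carrier L"
  shows "vnorm (X i) (x i) \<le> vnorm L x"
proof (rule powr_le_imp_le)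
  have "sum (\<lambda>i. vnorm (X i) (x i) powr p) {i} \<le> (\<Sum>i. vnorm (X i) (x i) powr p)"
    using vnorm_powr_sums[OF assms] by (intro sum_le_suminf) (auto simp: sums_iff)
  then show "vnorm (X i) (x i) powr p \<le> vnorm L x powr p"
    using vnorm_powr_sums[OF assms] by (simp add: sums_iff)
qed (use assms p in \<open>auto simp: L.vnorm_nonneg\<close>)

lemma vnorm_minus_coord_le:
  assumes "x \<in> carrier L" "y \<in> carrier L"
  shows "vnorm (X i) (x i \<ominus>\<^bsub>X i\<^esub> y i) \<le> vnorm L (x \<ominus>\<^bsub>L\<^esub> y)"
  using vnorm_coord_le[of "x \<ominus>\<^bsub>L\<^esub> y" i] assms by (simp add: lp_minus)

section \<open>Product sets and their radii\<close>

lemma closedin_Pi: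
  assumes "\<And>i. closedin (N.mtopology i) (A i)" "Pi UNIV A \<subseteq> carrier L"
  shows "closedin L.mtopology (Pi UNIV A)"
  unfolding L.closedin_metric
proof (intro conjI allI impI assms)
  fix x assume x: "x \<in> carrier L - Pi UNIV A"
  then obtain i where i: "x i \<in> carrier (X i) - A i"
    by (auto simp: lp_coord)
  then obtain r where r: "r > 0" "disjnt (A i) (N.mball i (x i) r)"
    using assms(1)[of i] unfolding N.closedin_metric by blast
  \<comment> \<open>Coordinate projections do not increase distances, so a ball that misses
    \<open>A i\<close> pulls back to a ball of the same radius that misses the product.\<close>
  have "disjnt (Pi UNIV A) (L.mball x r)"
    unfolding disjnt_iff
  proof safe
    fix y assume y: "y \<in> Pi UNIV A" "y \<in> L.mball x r"
    then have "vnorm (X i) (x i \<ominus>\<^bsub>X i\<^esub> y i) < r"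
      using vnorm_minus_coord_le[of x y i] by (auto simp: vdist_def)
    then have "y i \<in> N.mball i (x i) r"
      using y i by (auto simp: vdist_def lp_coord)
    with y r show False by (auto simp: disjnt_iff)
  qed
  with r show "\<exists>r>0. disjnt (Pi UNIV A) (L.mball x r)" by blast
qed

text \<open>Membership in \<open>closed_bounded_products\<close> with the family of factors made
  explicit, so that statements can refer to them.\<close>

definition lp_product :: "(nat \<Rightarrow> 'a) set \<Rightarrow> (nat \<Rightarrow> 'a set) \<Rightarrow> bool" where
  "lp_product F F' \<longleftrightarrow> F \<in> CB L \<and> (\<forall>i. F' i \<in> CB (X i)) \<and> F = Pi UNIV F'"

lemma closed_bounded_products_iff:
  "F \<in> closed_bounded_products p X \<longleftrightarrow> (\<exists>F'. lp_product F F')"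
  by (auto simp: closed_bounded_products_def lp_product_def)

lemma lp_productD:
  assumes "lp_product F F'"
  shows "F \<in> CB L" "F' i \<in> CB (X i)" "F = Pi UNIV F'"
  using assms by (auto simp: lp_product_def)

text \<open>Fullness of the product enters here: near-maximizers picked independently in all
  coordinates form a point of \<open>F\<close>.\<close>

lemma ex_scaled_radius_at_le_product:
  assumes "lp_product F F'" "x \<in> carrier L" "0 \<le> c" "c < 1"
  shows "\<exists>a\<in>F. \<forall>i. c * radius_at (X i) (x i) (F' i) \<le> vnorm (X i) (x i \<ominus>\<^bsub>X i\<^esub> a i)"
proof -
  have "\<exists>a\<in>F' i. c * radius_at (X i) (x i) (F' i) \<le> vnorm (X i) (x i \<ominus>\<^bsub>X i\<^esub> a)" for i
    using assms by (intro N.ex_scaled_radius_at_le) (auto simp: lp_productD lp_coord)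
  then obtain a where "\<And>i. a i \<in> F' i"
    "\<And>i. c * radius_at (X i) (x i) (F' i) \<le> vnorm (X i) (x i \<ominus>\<^bsub>X i\<^esub> a i)"
    by metis
  then show ?thesis
    using lp_productD(3)[OF assms(1)] by blast
qed

text \<open>For each point of \<open>F\<close> the distance is bounded term by term by the
  coordinate radii; conversely one point of \<open>F\<close> nearly attains all of them. Summability
  of the coordinate radii is part of the claim.\<close>

lemma radius_at_powr_sums:
  assumes F: "lp_product F F'" and x: "x \<in> carrier L"
  shows "(\<lambda>i. radius_at (X i) (x i) (F' i) powr p) sums (radius_at L x F powr p)"
proof -
  let ?r = "\<lambda>i. radius_at (X i) (x i) (F' i)" and ?R = "radius_at L x F"
  note FD = lp_productD[OF F]
  have carrier: "a \<in> carrier L" if "a \<in> F" for a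
    using that FD(1) L.CB_carrier by blast
  have r: "0 \<le> ?r i" for i
    using FD x by (auto intro!: N.radius_at_nonneg simp: lp_coord)
  have R: "0 \<le> ?R"
    using FD x by (auto intro!: L.radius_at_nonneg)
  \<comment> \<open>A common factor \<open>c < 1\<close> yields near-maximizers in all coordinates at once.\<close>
  have scaled: "summable (\<lambda>i. (c * ?r i) powr p) \<and> (\<Sum>i. (c * ?r i) powr p) \<le> ?R powr p"
    if c: "0 < c" "c < 1" for c
  proof -
    obtain a where a: "a \<in> F" "\<And>i. c * ?r i \<le> vnorm (X i) (x i \<ominus>\<^bsub>X i\<^esub> a i)"
      using ex_scaled_radius_at_le_product[OF F x, of c] c by auto
    note sums = vnorm_minus_powr_sums[OF x carrier[OF a(1)]]
    have le: "(c * ?r i) powr p \<le> vnorm (X i) (x i \<ominus>\<^bsub>X i\<^esub> a i) powr p" for i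
      using a r[of i] c p by (intro powr_mono2) auto
    have s: "summable (\<lambda>i. (c * ?r i) powr p)"
      using le by (intro summable_comparison_test'[OF sums_summable[OF sums]]) auto
    have "(\<Sum>i. (c * ?r i) powr p) \<le> vnorm L (x \<ominus>\<^bsub>L\<^esub> a) powr p"
      using suminf_le[OF le s sums_summable[OF sums]] sums_unique[OF sums] by simp
    also have "\<dots> \<le> ?R powr p"
      using FD x a p carrier by (intro powr_mono2 L.radius_at_upper L.vnorm_diff_nonneg) auto
    finally show ?thesis using s by blast
  qed
  \<comment> \<open>One fixed factor, here \<open>1 / 2\<close>, is enough for summability.\<close>
  have s: "summable (\<lambda>i. ?r i powr p)"
    using scaled[of "1 / 2"] r by (simp add: powr_mult powr_divide)
  let ?s = "(\<Sum>i. ?r i powr p) powr (1 / p)"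
  \<comment> \<open>Letting the factor tend to 1 recovers the full radii.\<close>
  have "?s \<le> ?R"
  proof (rule field_le_mult_one_interval)
    fix c :: real assume c: "0 < c" "c < 1"
    have "(c * ?s) powr p = c powr p * (\<Sum>i. ?r i powr p)"
      using c p s by (simp add: powr_mult powr_powr suminf_nonneg)
    also have "\<dots> \<le> ?R powr p"
      using scaled[OF c] c r s by (simp add: powr_mult suminf_mult)
    finally show "c * ?s \<le> ?R"
      by (rule powr_le_imp_le) (use R p in \<open>auto\<close>)
  qed
  moreover have "?R \<le> ?s"
  proof (rule L.radius_at_least[OF FD(1)])
    fix a assume a: "a \<in> F"
    note sums = vnorm_minus_powr_sums[OF x carrier[OF a]]
    have "vnorm L (x \<ominus>\<^bsub>L\<^esub> a) powr p \<le> (\<Sum>i. ?r i powr p)"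
      unfolding sums_unique[OF sums] using FD a x p carrier[OF a]
      by (intro suminf_le s sums_summable[OF sums] powr_mono2 N.radius_at_upper)
         (auto intro!: N.vnorm_diff_nonneg lp_coord)
    also have "\<dots> = ?s powr p"
      using p s by (simp add: powr_powr suminf_nonneg)
    finally show "vnorm L (x \<ominus>\<^bsub>L\<^esub> a) \<le> ?s"
      by (rule powr_le_imp_le) (use p in \<open>auto\<close>)
  qed
  ultimately have "?R = ?s" by simp
  then show ?thesis
    using s p by (simp add: powr_powr suminf_nonneg summable_sums)
qed

end

subsection \<open>Transfer of the property\<close>

text \<open>Zero in \<open>Y i\<close> allows a comparison of \<open>rad\<close> with the radius at
  zero, and keeps points with a single nonzero coordinate in the subspace.\<close>

locale lp_family_subspaces = lp_family X p for X :: "nat \<Rightarrow> 'a normed" and p +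
  fixes Y :: "nat \<Rightarrow> 'a set"
  assumes Y_subset: "\<And>i. Y i \<subseteq> carrier (X i)" and Y_zero: "\<And>i. \<zero>\<^bsub>X i\<^esub> \<in> Y i"
begin

lemma Y_nonempty: "Y i \<noteq> {}"
  using Y_zero by blast

abbreviation S :: "(nat \<Rightarrow> 'a) set" where "S \<equiv> lp_subspace p X Y"

section \<open>Centers of products and perturbation of products\<close>

lemma lp_subspace_iff: "y \<in> S \<longleftrightarrow> (\<forall>i. y i \<in> Y i) \<and> y \<in> carrier L"
  using Y_subset by (auto simp: lp_subspace_def lp_sum_def)

lemma lp_subspace_subset: "S \<subseteq> carrier L"
  by (auto simp: lp_subspace_iff)

lemma lp_subspace_zero: "(\<lambda>i. \<zero>\<^bsub>X i\<^esub>) \<in> S"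
  by (simp add: lp_subspace_iff Y_zero lp_zero_closed)

text \<open>The point to check is that a choice of coordinate centers has finite norm; after that it
  minimises the radius because it minimises every term of the p-sum.\<close>

lemma product_of_centers:
  assumes G: "lp_product G G'" and z: "\<And>i. z i \<in> centers (X i) (Y i) (G' i)"
  shows "z \<in> centers L S G"
    and "(\<lambda>i. rad (X i) (Y i) (G' i) powr p) sums (rad L S G powr p)"
proof -
  let ?rad = "\<lambda>i. rad (X i) (Y i) (G' i)" and ?rz = "\<lambda>i. radius_at (X i) \<zero>\<^bsub>X i\<^esub> (G' i)"
  note GD = lp_productD[OF G]
  have zY: "z i \<in> Y i" "z i \<in> carrier (X i)" and zr: "radius_at (X i) (z i) (G' i) = ?rad i" for i
    using z[of i] Y_subset[of i] by (auto simp: centers_def)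
  \<comment> \<open>Zero competes in \<open>Y i\<close>, so a center is no worse than zero; the p-th
    powers of the radii at zero are summable.\<close>
  have "vnorm (X i) (z i) \<le> 2 * ?rz i" for i
  proof -
    obtain a where a: "a \<in> G' i" "a \<in> carrier (X i)"
      using N.CB_nonempty[OF GD(2)] N.CB_carrier[OF GD(2)] by blast
    have "vnorm (X i) (z i) \<le> vnorm (X i) (z i \<ominus>\<^bsub>X i\<^esub> a) + vnorm (X i) a"
      using N.vnorm_diff_triangle[of "z i" i a "\<zero>\<^bsub>X i\<^esub>"] a zY by simp
    also have "\<dots> \<le> ?rad i + ?rz i"
      unfolding zr[symmetric]
      by (intro add_mono N.radius_at_upper N.radius_at_zero_upper GD a zY)
    also have "?rad i \<le> ?rz i"
      by (intro N.rad_lower GD Y_subset Y_zero)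
    finally show ?thesis by simp
  qed
  then have "vnorm (X i) (z i) powr p \<le> 2 powr p * ?rz i powr p" for i
    using powr_mono2[of p "vnorm (X i) (z i)" "2 * ?rz i"] p zY N.vnorm_nonneg N.radius_at_nonneg[OF GD(2), of "\<zero>\<^bsub>X i\<^esub>"]
    by (simp add: powr_mult)
  then have "z \<in> carrier L"
    using radius_at_powr_sums[OF G lp_zero_closed] zY(2)
    by (intro lp_carrierI[of z "\<lambda>i. 2 powr p * ?rz i powr p"]) (auto intro!: summable_mult sums_summable)
  then have zS: "z \<in> S" and zL: "z \<in> carrier L"
    using zY by (auto simp: lp_subspace_iff)
  have sums: "(\<lambda>i. ?rad i powr p) sums (radius_at L z G powr p)"
    using radius_at_powr_sums[OF G zL] by (simp add: zr)
  have "radius_at L z G \<le> radius_at L v G" if v: "v \<in> S" for v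
  proof (rule powr_le_imp_le)
    have vL: "v \<in> carrier L" and vY: "\<And>i. v i \<in> Y i" using v by (auto simp: lp_subspace_iff)
    show "radius_at L z G powr p \<le> radius_at L v G powr p"
    proof (rule sums_le[OF _ sums radius_at_powr_sums[OF G vL]])
      show "?rad i powr p \<le> radius_at (X i) (v i) (G' i) powr p" for i
        using p by (intro powr_mono2 N.rad_lower N.rad_nonneg GD vY Y_subset Y_nonempty) auto
    qed
    show "0 \<le> radius_at L v G" by (intro L.radius_at_nonneg GD vL)
  qed (use p in auto)
  then have "radius_at L z G \<le> rad L S G"
    using zS by (intro L.rad_greatest) auto
  moreover have "rad L S G \<le> radius_at L z G"
    by (intro L.rad_lower GD lp_subspace_subset zS)
  ultimately have eq: "radius_at L z G = rad L S G" by simp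
  then show "z \<in> centers L S G" using zS by (simp add: centers_def)
  show "(\<lambda>i. ?rad i powr p) sums (rad L S G powr p)"
    using sums by (simp add: eq)
qed

text \<open>Controls the p-tails of all \<open>G\<close> near \<open>F\<close> by the tail of
  \<open>F\<close> and an error \<open>w\<close> of total at most \<open>t powr p\<close>. One
  factor \<open>2 powr p\<close> comes from attaining the radii only up to one half, the other from
  \<open>powr_add_le\<close>.\<close>

lemma radius_at_zero_perturb:
  assumes F: "lp_product F F'" and G: "lp_product G G'"
    and near: "\<And>g. g \<in> G \<Longrightarrow> \<exists>f\<in>F. vnorm L (g \<ominus>\<^bsub>L\<^esub> f) \<le> t"
  shows "\<exists>w. (\<forall>i. 0 \<le> w i) \<and> summable w \<and> suminf w \<le> t powr p \<and>
    (\<forall>i. radius_at (X i) \<zero>\<^bsub>X i\<^esub> (G' i) powr p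
      \<le> 2 powr p * (2 powr p * (radius_at (X i) \<zero>\<^bsub>X i\<^esub> (F' i) powr p + w i)))"
proof -
  note FD = lp_productD[OF F] and GD = lp_productD[OF G]
  \<comment> \<open>A single \<open>g\<close> serves all coordinates, so a single \<open>f\<close>
    near it gives a summable error.\<close>
  obtain g where g: "g \<in> G"
    "\<And>i. 1 / 2 * radius_at (X i) \<zero>\<^bsub>X i\<^esub> (G' i) \<le> vnorm (X i) (\<zero>\<^bsub>X i\<^esub> \<ominus>\<^bsub>X i\<^esub> g i)"
    using ex_scaled_radius_at_le_product[OF G lp_zero_closed, of "1 / 2"] by auto
  obtain f where f: "f \<in> F" "vnorm L (g \<ominus>\<^bsub>L\<^esub> f) \<le> t"
    using near[OF g(1)] by blast
  have gL: "g \<in> carrier L" and fL: "f \<in> carrier L"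
    using g f L.CB_carrier GD(1) FD(1) by blast+
  have gX: "g i \<in> carrier (X i)" and fX: "f i \<in> carrier (X i)" and fF: "f i \<in> F' i" for i
    using gL fL f FD(3) by (auto simp: lp_coord)
  define w where "w i = vnorm (X i) (g i \<ominus>\<^bsub>X i\<^esub> f i) powr p" for i
  have sums: "w sums (vnorm L (g \<ominus>\<^bsub>L\<^esub> f) powr p)"
    unfolding w_def by (rule vnorm_minus_powr_sums[OF gL fL])
  have "radius_at (X i) \<zero>\<^bsub>X i\<^esub> (G' i) powr p
      \<le> 2 powr p * (2 powr p * (radius_at (X i) \<zero>\<^bsub>X i\<^esub> (F' i) powr p + w i))" for i
  proof -
    have "radius_at (X i) \<zero>\<^bsub>X i\<^esub> (G' i) \<le> 2 * vnorm (X i) (g i)"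
      using g(2)[of i] gX[of i] by (simp add: N.vnorm_minus)
    then have "radius_at (X i) \<zero>\<^bsub>X i\<^esub> (G' i) powr p \<le> (2 * vnorm (X i) (g i)) powr p"
      using p by (intro powr_mono2 N.radius_at_nonneg GD) auto
    also have "\<dots> = 2 powr p * vnorm (X i) (g i) powr p"
      by (simp add: powr_mult N.vnorm_nonneg gX)
    also have "\<dots> \<le> 2 powr p * (radius_at (X i) \<zero>\<^bsub>X i\<^esub> (F' i) + vnorm (X i) (g i \<ominus>\<^bsub>X i\<^esub> f i)) powr p"
    proof (intro mult_left_mono powr_mono2)
      show "vnorm (X i) (g i) \<le> radius_at (X i) \<zero>\<^bsub>X i\<^esub> (F' i) + vnorm (X i) (g i \<ominus>\<^bsub>X i\<^esub> f i)"
        using N.vnorm_diff_triangle[of "g i" i "f i" "\<zero>\<^bsub>X i\<^esub>"] gX[of i] fX[of i]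
          N.radius_at_zero_upper[OF FD(2) fF, of i] by simp
    qed (use p gX in \<open>auto intro: N.vnorm_nonneg\<close>)
    also have "\<dots> \<le> 2 powr p * (2 powr p * (radius_at (X i) \<zero>\<^bsub>X i\<^esub> (F' i) powr p + w i))"
      unfolding w_def using p
      by (intro mult_left_mono powr_add_le N.radius_at_nonneg N.vnorm_diff_nonneg FD gX fX) auto
    finally show ?thesis .
  qed
  moreover have "suminf w \<le> t powr p"
    unfolding sums_unique[OF sums, symmetric] using p f by (intro powr_mono2 L.vnorm_diff_nonneg gL fL) auto
  moreover have "\<forall>i. 0 \<le> w i" by (simp add: w_def)
  ultimately show ?thesis
    using sums_summable[OF sums] by blast
qed

text \<open>A point of a factor is completed to a point of the product, approximated there, and
  projected back.\<close>

lemma hausdorff_coord_le: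
  assumes F: "lp_product F F'" and G: "lp_product G G'" and t: "0 < t"
    and FG: "\<And>f. f \<in> F \<Longrightarrow> \<exists>g\<in>G. vnorm L (f \<ominus>\<^bsub>L\<^esub> g) \<le> t"
    and GF: "\<And>g. g \<in> G \<Longrightarrow> \<exists>f\<in>F. vnorm L (g \<ominus>\<^bsub>L\<^esub> f) \<le> t"
  shows "hausdorff (X i) (F' i) (G' i) \<le> t"
proof (rule N.hausdorff_le)
  have *: "\<exists>b\<in>B' i. vnorm (X i) (a \<ominus>\<^bsub>X i\<^esub> b) \<le> t"
    if A: "lp_product A A'" and B: "lp_product B B'" and a: "a \<in> A' i"
      and near: "\<And>f. f \<in> A \<Longrightarrow> \<exists>g\<in>B. vnorm L (f \<ominus>\<^bsub>L\<^esub> g) \<le> t" for A A' B B' a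
  proof -
    obtain f where f: "f \<in> A" using L.CB_nonempty lp_productD(1)[OF A] by blast
    \<comment> \<open>Exchanging one coordinate stays inside a full product.\<close>
    then have "f(i := a) \<in> A" using a lp_productD(3)[OF A] by auto
    then obtain g where g: "g \<in> B" "vnorm L (f(i := a) \<ominus>\<^bsub>L\<^esub> g) \<le> t"
      using near by blast
    have "vnorm (X i) ((f(i := a)) i \<ominus>\<^bsub>X i\<^esub> g i) \<le> t"
      using vnorm_minus_coord_le[of "f(i := a)" g i] g \<open>f(i := a) \<in> A\<close>
        L.CB_carrier lp_productD(1)[OF A] lp_productD(1)[OF B] by force
    then show ?thesis
      using g lp_productD(3)[OF B] by auto
  qed
  show "\<exists>b\<in>G' i. vnorm (X i) (a \<ominus>\<^bsub>X i\<^esub> b) \<le> t" if "a \<in> F' i" for a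
    by (rule *[OF F G that FG])
  show "\<exists>b\<in>F' i. vnorm (X i) (a \<ominus>\<^bsub>X i\<^esub> b) \<le> t" if "a \<in> G' i" for a
    by (rule *[OF G F that GF])
  show "F' i \<subseteq> carrier (X i)" "G' i \<subseteq> carrier (X i)"
    using N.CB_carrier[OF lp_productD(2)[OF F]] N.CB_carrier[OF lp_productD(2)[OF G]] by blast+
qed (rule t)

section \<open>From the coordinates to the sum\<close>

lemma property_lP2_lp_sum:
  assumes coord: "\<And>i. property_lP2 (X i) (Y i) (CB (X i))"
  shows "property_lP2 L S (closed_bounded_products p X)"
  unfolding property_lP2_def
proof (intro conjI ballI allI impI)
  have centers_nonempty: "\<exists>z. \<forall>i. z i \<in> centers (X i) (Y i) (G' i)" if "lp_product G G'" for G G'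
  proof -
    have "\<exists>z. z \<in> centers (X i) (Y i) (G' i)" for i
      using coord[of i] lp_productD(2)[OF that, of i] unfolding property_lP2_def by blast
    then show ?thesis by metis
  qed
  show "centers L S G \<noteq> {}" if "G \<in> closed_bounded_products p X" for G
    using that product_of_centers(1) centers_nonempty unfolding closed_bounded_products_iff by blast
  fix \<epsilon> :: real and F assume \<epsilon>: "\<epsilon> > 0" and "F \<in> closed_bounded_products p X"
  then obtain F' where F: "lp_product F F'"
    unfolding closed_bounded_products_iff by blast
  note FD = lp_productD[OF F]
  \<comment> \<open>\<open>\<eta>\<close> is the budget for the p-th power of the distance to a
    center: half for the first \<open>n\<close> coordinates, half for the rest. \<open>K\<close> is
    the constant of \<open>powr_add_le\<close>, and \<open>C\<close> collects its three uses in
    \<open>h_le\<close> with the factor 2 found there.\<close>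
  define \<eta> where "\<eta> = \<epsilon> powr p"
  define K where "K = (2::real) powr p"
  define C where "C = 2 * (K * (K * K))"
  have pos: "0 < \<eta>" "0 < K" "0 < C" using \<epsilon> by (auto simp: \<eta>_def K_def C_def)
  let ?\<rho> = "\<lambda>i. radius_at (X i) \<zero>\<^bsub>X i\<^esub> (F' i) powr p"
  have \<rho>: "summable ?\<rho>"
    using radius_at_powr_sums[OF F lp_zero_closed] by (rule sums_summable)
  have "0 < \<eta> / (8 * C)" using pos by simp
  \<comment> \<open>The cut-off depends on \<open>F\<close> only and therefore serves every nearby
    \<open>G\<close>.\<close>
  then obtain n where "norm (\<Sum>i. ?\<rho> (i + n)) < \<eta> / (8 * C)"
    using suminf_exist_split[OF _ \<rho>] by blast
  then have n: "(\<Sum>i. ?\<rho> (i + n)) < \<eta> / (8 * C)" by simp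
  \<comment> \<open>Makes \<open>n\<close> coordinates cost at most \<open>\<eta> / 2\<close>
    together; \<open>n + 1\<close> avoids division by zero.\<close>
  define \<epsilon>' where "\<epsilon>' = (\<eta> / (2 * (real n + 1))) powr (1 / p)"
  have \<epsilon>': "\<epsilon>' > 0" "\<epsilon>' powr p = \<eta> / (2 * (real n + 1))"
    using pos p by (auto simp: \<epsilon>'_def powr_powr)
  have "\<exists>d>0. \<forall>G\<in>CB (X i). hausdorff (X i) (F' i) G < d \<longrightarrow>
      near_centers (X i) (Y i) G d \<subseteq> enlarge (X i) (centers (X i) (Y i) G) \<epsilon>'" for i
    using coord[of i] \<epsilon>' FD(2)[of i] unfolding property_lP2_def by blast
  then obtain d where d: "\<And>i. d i > 0" "\<And>i G. G \<in> CB (X i) \<Longrightarrow> hausdorff (X i) (F' i) G < d i \<Longrightarrow>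
      near_centers (X i) (Y i) G (d i) \<subseteq> enlarge (X i) (centers (X i) (Y i) G) \<epsilon>'"
    by metis
  \<comment> \<open>The element 1 keeps the set nonempty when \<open>n\<close> is 0.\<close>
  define d1 where "d1 = Min (insert 1 (d ` {..<n}))"
  have d1: "d1 > 0" "\<And>i. i < n \<Longrightarrow> d1 \<le> d i"
    unfolding d1_def using d(1) by (auto intro!: Min_le)
  \<comment> \<open>The admissible total excess of p-th powers: the first bound serves each of the
    first \<open>n\<close> coordinates, the second the tail.\<close>
  define D where "D = min (d1 powr p) (\<eta> / (8 * K))"
  have D: "D > 0" using d1 pos by (auto simp: D_def)
  \<comment> \<open>Bounds the restricted radius of every \<open>G\<close> at Hausdorff distance
    less than 1 from \<open>F\<close>.\<close>
  define M where "M = radius_at L (\<lambda>i. \<zero>\<^bsub>X i\<^esub>) F + 1"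
  obtain \<theta> where \<theta>: "\<theta> > 0"
    "\<And>x t. 0 \<le> x \<Longrightarrow> x \<le> M \<Longrightarrow> 0 \<le> t \<Longrightarrow> t \<le> \<theta> \<Longrightarrow> (x + t) powr p \<le> x powr p + D"
    using powr_increment_uniform[of p D M] p D by auto
  \<comment> \<open>In turn: factors of \<open>G\<close> close to those of \<open>F\<close>, excess
    at most \<open>D\<close>, validity of the bound \<open>M\<close>, and a small perturbation error
    in the tail.\<close>
  define \<delta> where "\<delta> = min (min d1 \<theta>) (min 1 ((\<eta> / (8 * C)) powr (1 / p)))"
  have \<delta>: "\<delta> > 0" "\<delta> \<le> d1" "\<delta> \<le> \<theta>" "\<delta> \<le> 1" "\<delta> \<le> (\<eta> / (8 * C)) powr (1 / p)"
    using d1 \<theta> pos by (auto simp: \<delta>_def)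
  show "\<exists>\<delta>>0. \<forall>G\<in>closed_bounded_products p X. hausdorff L F G < \<delta> \<longrightarrow>
      near_centers L S G \<delta> \<subseteq> enlarge L (centers L S G) \<epsilon>"
  proof (intro exI[of _ \<delta>] conjI ballI impI subsetI \<delta>(1))
    fix G y assume "G \<in> closed_bounded_products p X" and FG: "hausdorff L F G < \<delta>"
      and y: "y \<in> near_centers L S G \<delta>"
    then obtain G' where G: "lp_product G G'"
      unfolding closed_bounded_products_iff by blast
    note GD = lp_productD[OF G]
    obtain t where t: "0 < t" "t < \<delta>" "\<And>f. f \<in> F \<Longrightarrow> \<exists>g\<in>G. vnorm L (f \<ominus>\<^bsub>L\<^esub> g) \<le> t"
      "\<And>g. g \<in> G \<Longrightarrow> \<exists>f\<in>F. vnorm L (g \<ominus>\<^bsub>L\<^esub> f) \<le> t"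
      using L.hausdorff_lessD[OF FD(1) GD(1) FG] by blast
    have yS: "y \<in> S" and yL: "y \<in> carrier L" and yY: "\<And>i. y i \<in> Y i"
      and yX: "\<And>i. y i \<in> carrier (X i)" and yR: "radius_at L y G \<le> rad L S G + \<delta>"
      using y by (auto simp: near_centers_def lp_subspace_iff lp_coord)
    let ?r = "\<lambda>i. radius_at (X i) (y i) (G' i)" and ?rad = "\<lambda>i. rad (X i) (Y i) (G' i)"
    let ?R = "rad L S G" and ?rz = "\<lambda>i. radius_at (X i) \<zero>\<^bsub>X i\<^esub> (G' i)"
    have rad: "0 \<le> ?rad i" "?rad i \<le> ?r i" "?rad i \<le> ?rz i" for i
      by (intro N.rad_nonneg N.rad_lower GD Y_subset Y_nonempty Y_zero yY)+
    have rad_sums: "(\<lambda>i. ?rad i powr p) sums (?R powr p)"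
      using product_of_centers(2)[OF G] centers_nonempty[OF G] by blast
    \<comment> \<open>The coordinate excess of the near-center; nonnegativity lets the total bound
      each single term and each tail.\<close>
    define s where "s i = ?r i powr p - ?rad i powr p" for i
    have s_sums: "s sums (radius_at L y G powr p - ?R powr p)"
      unfolding s_def by (intro sums_diff radius_at_powr_sums[OF G yL] rad_sums)
    have s_nonneg: "0 \<le> s i" for i
      using rad[of i] p by (auto simp: s_def intro!: powr_mono2)
    have R_le: "?R \<le> M"
    proof -
      have "?R \<le> radius_at L (\<lambda>i. \<zero>\<^bsub>X i\<^esub>) G"
        by (intro L.rad_lower GD lp_subspace_subset lp_subspace_zero)
      also have "\<dots> \<le> M"
      proof (rule L.radius_at_least[OF GD(1)])
        fix g assume g: "g \<in> G"
        then obtain f where f: "f \<in> F" "vnorm L (g \<ominus>\<^bsub>L\<^esub> f) \<le> t" using t by blast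
        have car: "f \<in> carrier L" "g \<in> carrier L" using f g FD(1) GD(1) L.CB_carrier by blast+
        then have "vnorm L (\<zero>\<^bsub>L\<^esub> \<ominus>\<^bsub>L\<^esub> g) \<le> vnorm L (\<zero>\<^bsub>L\<^esub> \<ominus>\<^bsub>L\<^esub> f) + vnorm L (g \<ominus>\<^bsub>L\<^esub> f)"
          using L.vnorm_diff_triangle[of "\<zero>\<^bsub>L\<^esub>" f g] L.vnorm_diff_commute[of f g] L.M.zero_closed by metis
        also have "\<dots> \<le> radius_at L \<zero>\<^bsub>L\<^esub> F + 1"
          using f t \<delta> by (intro add_mono L.radius_at_upper FD L.M.zero_closed) auto
        finally show "vnorm L ((\<lambda>i. \<zero>\<^bsub>X i\<^esub>) \<ominus>\<^bsub>L\<^esub> g) \<le> M"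
          by (simp add: M_def)
      qed
      finally show ?thesis .
    qed
    have R_nonneg: "0 \<le> ?R"
      using lp_subspace_zero by (intro L.rad_nonneg GD lp_subspace_subset) auto
    \<comment> \<open>The additive slack in the radius becomes a total excess of at most
      \<open>D\<close> in p-th powers.\<close>
    have "radius_at L y G powr p \<le> (?R + \<delta>) powr p"
      using yR p by (intro powr_mono2 L.radius_at_nonneg GD yL) auto
    also have "\<dots> \<le> ?R powr p + D"
      using R_nonneg R_le \<delta> by (intro \<theta>(2)) auto
    finally have sD: "suminf s \<le> D"
      using sums_unique[OF s_sums] by simp
    have head: "\<exists>z\<in>centers (X i) (Y i) (G' i). vnorm (X i) (y i \<ominus>\<^bsub>X i\<^esub> z) \<le> \<epsilon>'" if i: "i < n" for i
    proof -
      have "sum s {i} \<le> suminf s"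
        using s_nonneg by (intro sum_le_suminf sums_summable[OF s_sums]) auto
      then have "?r i powr p \<le> ?rad i powr p + d1 powr p"
        using sD by (auto simp: s_def D_def)
      also have "\<dots> \<le> (?rad i + d1) powr p"
        using rad d1 p by (intro powr_add_ge) auto
      finally have "?r i \<le> ?rad i + d1"
        by (rule powr_le_imp_le) (use rad[of i] d1 p in auto)
      then have "y i \<in> near_centers (X i) (Y i) (G' i) (d i)"
        using d1(2)[OF i] yY by (auto simp: near_centers_def)
      moreover have "hausdorff (X i) (F' i) (G' i) < d i"
        using hausdorff_coord_le[OF F G t(1,3,4), of i] t(2) \<delta>(2) d1(2)[OF i] by auto
      ultimately have "y i \<in> enlarge (X i) (centers (X i) (Y i) (G' i)) \<epsilon>'"
        using d(2)[OF GD(2)] by blast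
      moreover have "centers (X i) (Y i) (G' i) \<subseteq> carrier (X i)"
        using Y_subset by (auto simp: centers_def)
      ultimately show ?thesis
        using \<epsilon>' by (auto simp: N.mem_enlarge_iff)
    qed
    \<comment> \<open>Beyond \<open>n\<close> an arbitrary center is taken.\<close>
    have "\<exists>z. z \<in> centers (X i) (Y i) (G' i) \<and> (i < n \<longrightarrow> vnorm (X i) (y i \<ominus>\<^bsub>X i\<^esub> z) \<le> \<epsilon>')" for i
      using head[of i] centers_nonempty[OF G] by (cases "i < n") auto
    then obtain z where z: "\<And>i. z i \<in> centers (X i) (Y i) (G' i)"
      "\<And>i. i < n \<Longrightarrow> vnorm (X i) (y i \<ominus>\<^bsub>X i\<^esub> z i) \<le> \<epsilon>'"
      by metis
    have zC: "z \<in> centers L S G" by (rule product_of_centers(1)[OF G z(1)])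
    then have zL: "z \<in> carrier L" using lp_subspace_subset by (auto simp: centers_def)
    have zX: "z i \<in> carrier (X i)" for i using zL by (rule lp_coord)
    obtain w where w: "\<And>i. 0 \<le> w i" "summable w" "suminf w \<le> t powr p"
      "\<And>i. ?rz i powr p \<le> K * (K * (?\<rho> i + w i))"
      using radius_at_zero_perturb[OF F G t(4)] unfolding K_def by blast
    let ?h = "\<lambda>i. vnorm (X i) (y i \<ominus>\<^bsub>X i\<^esub> z i) powr p"
    have h_sums: "?h sums (vnorm L (y \<ominus>\<^bsub>L\<^esub> z) powr p)"
      by (rule vnorm_minus_powr_sums[OF yL zL])
    \<comment> \<open>Passing through a point of \<open>G' i\<close> gives the bound
      \<open>?r i + ?rad i\<close>; then \<open>?r i powr p\<close> is split into excess plus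
      \<open>?rad i powr p\<close>, and the latter is estimated by the radius at zero.\<close>
    have h_le: "?h i \<le> K * s i + (C * ?\<rho> i + C * w i)" for i
    proof -
      obtain a where a: "a \<in> G' i" "a \<in> carrier (X i)"
        using N.CB_nonempty[OF GD(2)] N.CB_carrier[OF GD(2)] by blast
      have "vnorm (X i) (y i \<ominus>\<^bsub>X i\<^esub> z i) \<le> vnorm (X i) (y i \<ominus>\<^bsub>X i\<^esub> a) + vnorm (X i) (z i \<ominus>\<^bsub>X i\<^esub> a)"
        using N.vnorm_diff_triangle[of "y i" i a "z i"] N.vnorm_diff_commute[of a i "z i"] a yX zX by simp
      also have "\<dots> \<le> ?r i + radius_at (X i) (z i) (G' i)"
        by (intro add_mono N.radius_at_upper GD yX zX a)
      also have "\<dots> = ?r i + ?rad i"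
        using z(1)[of i] by (simp add: centers_def)
      finally have "?h i \<le> (?r i + ?rad i) powr p"
        using p by (intro powr_mono2 N.vnorm_diff_nonneg yX zX) auto
      also have "\<dots> \<le> K * (?r i powr p + ?rad i powr p)"
        unfolding K_def using rad[of i] p by (intro powr_add_le) auto
      also have "\<dots> = K * s i + 2 * K * ?rad i powr p"
        by (simp add: s_def algebra_simps)
      also have "?rad i powr p \<le> ?rz i powr p"
        using rad[of i] p by (intro powr_mono2) auto
      also have "\<dots> \<le> K * (K * (?\<rho> i + w i))" by (rule w(4))
      finally show ?thesis
        using pos by (simp add: C_def algebra_simps)
    qed
    have summable_shift: "summable (\<lambda>i. s (i + n))" "summable (\<lambda>i. ?\<rho> (i + n))" "summable (\<lambda>i. w (i + n))"
        "summable (\<lambda>i. ?h (i + n))"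
      using summable_ignore_initial_segment sums_summable[OF s_sums] \<rho> w(2) sums_summable[OF h_sums] by blast+
    have "(\<Sum>i. ?h (i + n)) \<le> (\<Sum>i. K * s (i + n) + (C * ?\<rho> (i + n) + C * w (i + n)))"
      by (intro suminf_le h_le summable_add summable_mult summable_shift)
    also have "\<dots> = K * (\<Sum>i. s (i + n)) + (C * (\<Sum>i. ?\<rho> (i + n)) + C * (\<Sum>i. w (i + n)))"
      by (simp only: suminf_add[symmetric] suminf_mult summable_add summable_mult summable_shift)
    \<comment> \<open>Three contributions of \<open>\<eta> / 8\<close>: excess, tail of
      \<open>F\<close>, and perturbation.\<close>
    also have "\<dots> \<le> K * (\<eta> / (8 * K)) + (C * (\<eta> / (8 * C)) + C * (\<eta> / (8 * C)))"
    proof (intro add_mono mult_left_mono)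
      show "(\<Sum>i. s (i + n)) \<le> \<eta> / (8 * K)"
        using suminf_tail_le[OF sums_summable[OF s_sums] s_nonneg, of n] sD by (auto simp: D_def)
      have "(\<Sum>i. w (i + n)) \<le> t powr p"
        using suminf_tail_le[OF w(2,1), of n] w(3) by auto
      also have "\<dots> \<le> ((\<eta> / (8 * C)) powr (1 / p)) powr p"
        using t \<delta> p by (intro powr_mono2) auto
      also have "\<dots> = \<eta> / (8 * C)"
        using p pos by (simp add: powr_powr)
      finally show "(\<Sum>i. w (i + n)) \<le> \<eta> / (8 * C)" .
    qed (use n pos in auto)
    finally have tail: "(\<Sum>i. ?h (i + n)) \<le> \<eta> / 2"
      using pos by simp
    have "(\<Sum>i<n. ?h i) \<le> (\<Sum>i<n. \<epsilon>' powr p)"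
      using z(2) p by (intro sum_mono powr_mono2 N.vnorm_diff_nonneg yX zX) auto
    also have "\<dots> \<le> \<eta> / 2"
      using pos by (simp add: \<epsilon>' field_simps)
    finally have "suminf ?h \<le> \<eta>"
      using tail suminf_split_initial_segment[OF sums_summable[OF h_sums], of n] by simp
    then have "vnorm L (y \<ominus>\<^bsub>L\<^esub> z) powr p \<le> \<epsilon> powr p"
      using sums_unique[OF h_sums] by (simp add: \<eta>_def)
    then have "vnorm L (y \<ominus>\<^bsub>L\<^esub> z) \<le> \<epsilon>"
      by (rule powr_le_imp_le) (use \<epsilon> p in auto)
    moreover have "centers L S G \<subseteq> carrier L"
      using lp_subspace_subset by (auto simp: centers_def)
    ultimately show "y \<in> enlarge L (centers L S G) \<epsilon>"
      using \<epsilon> zC yL by (auto simp: L.mem_enlarge_iff)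
  qed
qed

section \<open>Embedding of one coordinate and the converse direction\<close>

definition single :: "nat \<Rightarrow> 'a \<Rightarrow> nat \<Rightarrow> 'a" where
  "single i a = (\<lambda>j. \<zero>\<^bsub>X j\<^esub>)(i := a)"

text \<open>The singletons of zero make the embedded copy of \<open>A\<close> a full
  product.\<close>

definition single_set :: "nat \<Rightarrow> 'a set \<Rightarrow> nat \<Rightarrow> 'a set" where
  "single_set i A = (\<lambda>j. {\<zero>\<^bsub>X j\<^esub>})(i := A)"

lemma single_same [simp]: "single i a i = a"
  by (simp add: single_def)

lemma single_powr_sums: "a \<in> carrier (X i) \<Longrightarrow> (\<lambda>j. vnorm (X j) (single i a j) powr p) sums (vnorm (X i) a powr p)"
  using sums_single[of i "\<lambda>j. vnorm (X i) a powr p"]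
  by (rule sums_cong[THEN iffD1, rotated]) (auto simp: single_def)

lemma single_closed:
  assumes "a \<in> carrier (X i)"
  shows "single i a \<in> carrier L"
  using sums_summable[OF single_powr_sums[OF assms]] assms unfolding lp_carrier_iff
  by (auto simp: single_def)

lemma vnorm_single:
  assumes "a \<in> carrier (X i)"
  shows "vnorm L (single i a) = vnorm (X i) a"
  unfolding lp_vnorm sums_unique[OF single_powr_sums[OF assms], symmetric]
  using assms p by (simp add: powr_powr N.vnorm_nonneg)

lemma single_minus:
  assumes "a \<in> carrier (X i)" "b \<in> carrier (X i)"
  shows "single i a \<ominus>\<^bsub>L\<^esub> single i b = single i (a \<ominus>\<^bsub>X i\<^esub> b)"
proof
  fix j
  show "(single i a \<ominus>\<^bsub>L\<^esub> single i b) j = single i (a \<ominus>\<^bsub>X i\<^esub> b) j"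
    unfolding lp_minus[OF single_closed[OF assms(1)] single_closed[OF assms(2)]] by (simp add: single_def)
qed

lemma single_mem_subspace: "a \<in> Y i \<Longrightarrow> single i a \<in> S"
  using Y_subset[of i] Y_zero by (auto simp: lp_subspace_iff single_closed) (simp add: single_def)

lemma Pi_single_set: "Pi UNIV (single_set i A) = single i ` A"
proof
  show "Pi UNIV (single_set i A) \<subseteq> single i ` A"
  proof
    fix x assume x: "x \<in> Pi UNIV (single_set i A)"
    then have mem: "x j \<in> single_set i A j" for j by auto
    have "x j = single i (x i) j" for j
      using mem[of j] by (auto simp: single_set_def single_def)
    then have "x = single i (x i)" by (rule ext)
    moreover have "x i \<in> A"
      using mem[of i] by (simp add: single_set_def)
    ultimately show "x \<in> single i ` A" by blast
  qed
qed (auto simp: single_set_def single_def)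

text \<open>Closedness comes from the product form, boundedness from \<open>single i\<close>
  preserving norms.\<close>

lemma lp_product_single:
  assumes "A \<in> CB (X i)"
  shows "lp_product (single i ` A) (single_set i A)"
proof -
  have A: "single_set i A j \<in> CB (X j)" for j
    using assms N.zero_singleton_in_CB by (auto simp: single_set_def)
  have sub: "single i ` A \<subseteq> carrier L"
    using N.CB_carrier[OF assms] single_closed by auto
  have "closedin L.mtopology (Pi UNIV (single_set i A))"
    using A sub by (intro closedin_Pi) (auto simp: N.mem_CB_iff Pi_single_set)
  moreover obtain B where "\<And>a. a \<in> A \<Longrightarrow> vnorm (X i) a \<le> B"
    using assms by (auto simp: N.mem_CB_iff)
  ultimately have "single i ` A \<in> CB L"
    using N.CB_nonempty[OF assms] N.CB_carrier[OF assms] unfolding L.mem_CB_iff Pi_single_set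
    by (auto simp: vnorm_single intro!: exI[of _ B])
  then show ?thesis
    using A by (simp add: lp_product_def Pi_single_set)
qed

text \<open>Projection does not increase distances; \<open>v\<close> is arbitrary, so competitors
  outside the embedded copy are covered.\<close>

lemma radius_at_coord_le:
  assumes "A \<in> CB (X i)" "v \<in> carrier L"
  shows "radius_at (X i) (v i) A \<le> radius_at L v (single i ` A)"
proof (rule N.radius_at_least[OF assms(1)])
  fix a assume a: "a \<in> A"
  then have "a \<in> carrier (X i)" using N.CB_carrier assms by blast
  then have "vnorm (X i) (v i \<ominus>\<^bsub>X i\<^esub> a) \<le> vnorm L (v \<ominus>\<^bsub>L\<^esub> single i a)"
    using vnorm_minus_coord_le[of v "single i a" i] assms by (simp add: single_closed)
  also have "\<dots> \<le> radius_at L v (single i ` A)"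
    using assms a lp_product_single by (intro L.radius_at_upper) (auto dest: lp_productD)
  finally show "vnorm (X i) (v i \<ominus>\<^bsub>X i\<^esub> a) \<le> radius_at L v (single i ` A)" .
qed

lemma radius_at_single:
  assumes "A \<in> CB (X i)" "y \<in> carrier (X i)"
  shows "radius_at L (single i y) (single i ` A) = radius_at (X i) y A"
proof -
  have "vnorm L (single i y \<ominus>\<^bsub>L\<^esub> single i a) = vnorm (X i) (y \<ominus>\<^bsub>X i\<^esub> a)" if "a \<in> A" for a
    using assms N.CB_carrier[OF assms(1) that] by (simp add: single_minus vnorm_single)
  then show ?thesis
    unfolding radius_at_def image_image by simp
qed

text \<open>Embedding competitors from \<open>Y i\<close> gives \<open>\<le>\<close>; projecting
  arbitrary competitors from \<open>S\<close> gives \<open>\<ge>\<close>.\<close>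

lemma rad_single:
  assumes "A \<in> CB (X i)"
  shows "rad L S (single i ` A) = rad (X i) (Y i) A"
proof (rule antisym)
  have A: "single i ` A \<in> CB L"
    using lp_product_single[OF assms] by (rule lp_productD)
  show "rad L S (single i ` A) \<le> rad (X i) (Y i) A"
  proof (rule N.rad_greatest)
    fix v assume v: "v \<in> Y i"
    then have "v \<in> carrier (X i)" using Y_subset by blast
    then show "rad L S (single i ` A) \<le> radius_at (X i) v A"
      using L.rad_lower[OF A lp_subspace_subset single_mem_subspace[OF v]] assms by (simp add: radius_at_single)
  qed (use Y_zero in auto)
  show "rad (X i) (Y i) A \<le> rad L S (single i ` A)"
  proof (rule L.rad_greatest)
    fix v assume v: "v \<in> S"
    have "rad (X i) (Y i) A \<le> radius_at (X i) (v i) A"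
      using v by (intro N.rad_lower assms Y_subset) (auto simp: lp_subspace_iff)
    also have "\<dots> \<le> radius_at L v (single i ` A)"
      using v assms by (intro radius_at_coord_le) (auto simp: lp_subspace_iff)
    finally show "rad (X i) (Y i) A \<le> radius_at L v (single i ` A)" .
  qed (use lp_subspace_zero in auto)
qed

text \<open>Projection cannot increase the radius, and the two restricted radii agree.\<close>

lemma center_coord:
  assumes "A \<in> CB (X i)" "z \<in> centers L S (single i ` A)"
  shows "z i \<in> centers (X i) (Y i) A"
proof -
  have z: "z \<in> S" "z i \<in> Y i" "z \<in> carrier L" using assms by (auto simp: centers_def lp_subspace_iff)
  have "radius_at (X i) (z i) A \<le> rad (X i) (Y i) A"
    using radius_at_coord_le[OF assms(1) z(3)] assms by (simp add: centers_def rad_single)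
  moreover have "rad (X i) (Y i) A \<le> radius_at (X i) (z i) A"
    by (intro N.rad_lower assms Y_subset z)
  ultimately show ?thesis using z by (simp add: centers_def)
qed

lemma hausdorff_single_less:
  assumes "A \<in> CB (X i)" "B \<in> CB (X i)" "hausdorff (X i) A B < d"
  shows "hausdorff L (single i ` A) (single i ` B) < d"
proof -
  note car = N.CB_carrier[OF assms(1)] N.CB_carrier[OF assms(2)]
  obtain t where t: "0 < t" "t < d" "\<And>a. a \<in> A \<Longrightarrow> \<exists>b\<in>B. vnorm (X i) (a \<ominus>\<^bsub>X i\<^esub> b) \<le> t"
    "\<And>b. b \<in> B \<Longrightarrow> \<exists>a\<in>A. vnorm (X i) (b \<ominus>\<^bsub>X i\<^esub> a) \<le> t"
    using N.hausdorff_lessD[OF assms] by blast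
  have "hausdorff L (single i ` A) (single i ` B) \<le> t"
    using t car by (intro L.hausdorff_le) (auto simp: single_closed single_minus vnorm_single)
  then show ?thesis using t by simp
qed

text \<open>The same \<open>\<delta>\<close> works: embed the near-center, move it to a center in
  the sum, and project that center back.\<close>

lemma property_lP2_coord:
  assumes "property_lP2 L S (closed_bounded_products p X)"
  shows "property_lP2 (X i) (Y i) (CB (X i))"
  unfolding property_lP2_def
proof (intro conjI ballI allI impI)
  have cbp: "single i ` A \<in> closed_bounded_products p X" if "A \<in> CB (X i)" for A
    using lp_product_single[OF that] closed_bounded_products_iff by blast
  show "centers (X i) (Y i) A \<noteq> {}" if "A \<in> CB (X i)" for A
    using assms cbp[OF that] center_coord[OF that] unfolding property_lP2_def by blast
  fix \<epsilon> :: real and F assume \<epsilon>: "\<epsilon> > 0" and F: "F \<in> CB (X i)"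
  then obtain \<delta> where \<delta>: "\<delta> > 0"
    "\<And>G. G \<in> closed_bounded_products p X \<Longrightarrow> hausdorff L (single i ` F) G < \<delta> \<Longrightarrow>
      near_centers L S G \<delta> \<subseteq> enlarge L (centers L S G) \<epsilon>"
    using assms cbp[OF F] unfolding property_lP2_def by blast
  show "\<exists>\<delta>>0. \<forall>G\<in>CB (X i). hausdorff (X i) F G < \<delta> \<longrightarrow>
      near_centers (X i) (Y i) G \<delta> \<subseteq> enlarge (X i) (centers (X i) (Y i) G) \<epsilon>"
  proof (intro exI[of _ \<delta>] conjI ballI impI subsetI \<delta>(1))
    fix G y assume G: "G \<in> CB (X i)" and FG: "hausdorff (X i) F G < \<delta>"
      and y: "y \<in> near_centers (X i) (Y i) G \<delta>"
    have yY: "y \<in> Y i" and yX: "y \<in> carrier (X i)"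
      using y Y_subset[of i] by (auto simp: near_centers_def)
    have "single i y \<in> near_centers L S (single i ` G) \<delta>"
      using y yX yY G by (simp add: near_centers_def single_mem_subspace radius_at_single rad_single)
    then have "single i y \<in> enlarge L (centers L S (single i ` G)) \<epsilon>"
      using \<delta>(2)[OF cbp[OF G] hausdorff_single_less[OF F G FG]] by blast
    moreover have sub: "centers L S (single i ` G) \<subseteq> carrier L" "centers (X i) (Y i) G \<subseteq> carrier (X i)"
      using lp_subspace_subset Y_subset[of i] by (auto simp: centers_def)
    ultimately obtain z where z: "z \<in> centers L S (single i ` G)" "vnorm L (single i y \<ominus>\<^bsub>L\<^esub> z) \<le> \<epsilon>"
      using \<epsilon> by (auto simp: L.mem_enlarge_iff)
    have "vnorm (X i) (y \<ominus>\<^bsub>X i\<^esub> z i) \<le> \<epsilon>"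
      using vnorm_minus_coord_le[of "single i y" z i] z yX sub single_closed by fastforce
    then show "y \<in> enlarge (X i) (centers (X i) (Y i) G) \<epsilon>"
      using \<epsilon> sub yX center_coord[OF G z(1)] by (auto simp: N.mem_enlarge_iff)
  qed
qed

end

theorem theorem3p20:
  fixes X :: "nat \<Rightarrow> 'a normed" and Y :: "nat \<Rightarrow> 'a set" and p :: real
  assumes "\<And>i. banach_space (X i)"
    and "\<And>i. closed_subspace (X i) (Y i)"
    and "1 \<le> p"
  shows "(\<forall>i. property_lP2 (X i) (Y i) (CB (X i))) \<longleftrightarrow>
    property_lP2 (lp_sum p X) (lp_subspace p X Y) (closed_bounded_products p X)"
proof -
  interpret lp_family_subspaces X p Y
  proof (intro lp_family_subspaces.intro lp_family.intro lp_family_subspaces_axioms.intro)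
    fix i
    interpret banach_space "X i" by (rule assms)
    show "normed_module (X i)" by (rule normed_module)
    have "submodule (Y i) real_ring (X i)"
      using assms(2) by (simp add: closed_subspace_def)
    then interpret submodule "Y i" real_ring "X i" .
    \<comment> \<open>A submodule is a subgroup of the additive monoid, whose neutral element is
      zero; hence \<open>one_closed\<close>.\<close>
    show "Y i \<subseteq> carrier (X i)" "\<zero>\<^bsub>X i\<^esub> \<in> Y i"
      using subset one_closed by simp_all
  qed (rule assms)
  show ?thesis
    using property_lP2_lp_sum property_lP2_coord by blast
qed

end
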